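(* Let $k,s$ be positive integers and let $p_0\geq p_1\geq\cdots\geq p_s>0$ be arbitrary real numbers, $\vec{p}=(p_0,\ldots,p_s)$. Then $$f_{\vec{p}}((s+1)k,k,s)=(p_0+p_1+\cdots+p_s)\binom{(s+1)k-1}{k}.$$
   Context: $[n]=\{1,\ldots,n\}$ and $\binom{[n]}{k}$ is the collection of all $k$-element subsets of $[n]$. For families $\mathcal{A}_1,\ldots,\mathcal{A}_m\subseteq 2^{[n]}$ the rainbow matching number $\nu(\mathcal{A}_1,\ldots,\mathcal{A}_m)$ is the maximum integer $r$ such that there are indices $1\leq i_1<\cdots<i_r\leq m$ and pairwise disjoint sets $A_{i_1}\in\mathcal{A}_{i_1},\ldots,A_{i_r}\in\mathcal{A}_{i_r}$. A sequence of $s+1$ families $\mathcal{B}_0,\mathcal{B}_1,\ldots,\mathcal{B}_s\subseteq 2^{[n]}$ is called overlapping if $\nu(\mathcal{B}_0,\ldots,\mathcal{B}_s)\leq s$, i.e. one cannot choose pairwise disjoint sets $B_i\in\mathcal{B}_i$, $i=0,\ldots,s$. For real constants $p_0\geq p_1\geq\cdots\geq p_s>0$, $\vec{p}=(p_0,\ldots,p_s)$ and $n\geq (s+1)k$, define $$f_{\vec{p}}(n,k,s)=\max\left\{\sum_{i=0}^s p_i|\mathcal{B}_i| : \mathcal{B}_0\subseteq\mathcal{B}_1\subseteq\cdots\subseteq\mathcal{B}_s\subseteq\binom{[n]}{k}\text{ are overlapping}\right\}$$ (families may be empty and may coincide). *)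

theory Defs
  imports Complex_Main "HOL-Library.Disjoint_Sets" "HOL-Library.Ramsey"
begin

text \<open>
  The families \<open>\<A> i\<close> are indexed by a finite set \<open>I\<close>; only their values on \<open>I\<close> matter.
  \<open>J\<close> is the set of chosen indices and \<open>M i \<in> \<A> i\<close> the chosen set; \<open>J = {}\<close> is
  always admissible, so the maximum is taken over a nonempty finite set.
\<close>
definition rainbow_matching_number :: "nat set \<Rightarrow> (nat \<Rightarrow> nat set set) \<Rightarrow> nat" where
  "rainbow_matching_number I \<A> =
     Max {card J | J M. J \<subseteq> I \<and> (\<forall>i\<in>J. M i \<in> \<A> i) \<and> disjoint_family_on M J}"

definition overlapping :: "nat \<Rightarrow> (nat \<Rightarrow> nat set set) \<Rightarrow> bool" where
  "overlapping s \<B> \<longleftrightarrow> rainbow_matching_number {0..s} \<B> \<le> s"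

text \<open>
  Here \<open>nsets {1..n} k\<close> is the collection of all \<open>k\<close>-element subsets of \<open>{1..n}\<close>,
  and \<open>mono_on {0..s} \<B>\<close> says \<open>\<B> 0 \<subseteq> \<B> 1 \<subseteq> \<dots> \<subseteq> \<B> s\<close>.
\<close>
definition max_weight :: "(nat \<Rightarrow> real) \<Rightarrow> nat \<Rightarrow> nat \<Rightarrow> nat \<Rightarrow> real" where
  "max_weight p n k s =
     Max {(\<Sum>i=0..s. p i * real (card (\<B> i))) | \<B>.
            mono_on {0..s} \<B> \<and> (\<forall>i\<in>{0..s}. \<B> i \<subseteq> nsets {1..n} k) \<and> overlapping s \<B>}"

lemma rainbow_set_finite_nonempty:
  fixes I :: "nat set" and \<A> :: "nat \<Rightarrow> nat set set"
  assumes "finite I"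
  shows "finite {card J | J M. J \<subseteq> I \<and> (\<forall>i\<in>J. M i \<in> \<A> i) \<and> disjoint_family_on M J}"
    and "{card J | J M. J \<subseteq> I \<and> (\<forall>i\<in>J. M i \<in> \<A> i) \<and> disjoint_family_on M J} \<noteq> {}"
proof -
  have "{card J | J M. J \<subseteq> I \<and> (\<forall>i\<in>J. M i \<in> \<A> i) \<and> disjoint_family_on M J} \<subseteq> card ` Pow I"
    by auto
  then show "finite {card J | J M. J \<subseteq> I \<and> (\<forall>i\<in>J. M i \<in> \<A> i) \<and> disjoint_family_on M J}"
    using assms by (meson finite_Pow_iff finite_imageI finite_subset)
  have "{} \<subseteq> I \<and> (\<forall>i\<in>({} :: nat set). M i \<in> \<A> i) \<and> disjoint_family_on M {}" for M :: "nat \<Rightarrow> nat set"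
    by (simp add: disjoint_family_on_def)
  then show "{card J | J M. J \<subseteq> I \<and> (\<forall>i\<in>J. M i \<in> \<A> i) \<and> disjoint_family_on M J} \<noteq> {}"
    by blast
qed

lemma overlapping_iff:
  "overlapping s \<B> \<longleftrightarrow> (\<nexists>M. (\<forall>i\<in>{0..s}. M i \<in> \<B> i) \<and> disjoint_family_on M {0..s})"
proof -
  note fn = rainbow_set_finite_nonempty[of "{0..s}" \<B>, OF finite_atLeastAtMost]
  have full: "J = {0..s}" if "J \<subseteq> {0..s}" "\<not> card J \<le> s" for J
    using that card_subset_eq[of "{0..s}" J] card_mono[of "{0..s}" J] by simp
  have "overlapping s \<B> \<longleftrightarrow>
      (\<forall>J M. J \<subseteq> {0..s} \<and> (\<forall>i\<in>J. M i \<in> \<B> i) \<and> disjoint_family_on M J \<longrightarrow> card J \<le> s)"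
    unfolding overlapping_def rainbow_matching_number_def Max_le_iff[OF fn] by blast
  also have "\<dots> \<longleftrightarrow> (\<nexists>M. (\<forall>i\<in>{0..s}. M i \<in> \<B> i) \<and> disjoint_family_on M {0..s})"
    (is "?L \<longleftrightarrow> ?R")
  proof
    assume L: ?L
    show ?R
    proof
      assume "\<exists>M. (\<forall>i\<in>{0..s}. M i \<in> \<B> i) \<and> disjoint_family_on M {0..s}"
      then have "card {0..s} \<le> s"
        using L by blast
      then show False by simp
    qed
  next
    assume ?R
    then show ?L using full by metis
  qed
  finally show ?thesis .
qed

lemma max_weight_set_finite_nonempty:
  fixes p :: "nat \<Rightarrow> real" and n k s :: nat
  defines "S \<equiv> {(\<Sum>i=0..s. p i * real (card (\<B> i))) | \<B>.
            mono_on {0..s} \<B> \<and> (\<forall>i\<in>{0..s}. \<B> i \<subseteq> nsets {1..n} k) \<and> overlapping s \<B>}"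
  shows "finite S" and "S \<noteq> {}"
proof -
  let ?F = "PiE {0..s} (\<lambda>_. Pow (nsets {1..n} k))"
  have "S \<subseteq> (\<lambda>\<B>. \<Sum>i=0..s. p i * real (card (\<B> i))) ` ?F"
  proof
    fix x assume "x \<in> S"
    then obtain \<B> where x: "x = (\<Sum>i=0..s. p i * real (card (\<B> i)))"
      and \<B>: "\<forall>i\<in>{0..s}. \<B> i \<subseteq> nsets {1..n} k"
      unfolding S_def by blast
    have "x = (\<Sum>i=0..s. p i * real (card (restrict \<B> {0..s} i)))"
      unfolding x by (rule sum.cong) auto
    moreover have "restrict \<B> {0..s} \<in> ?F"
      using \<B> by (intro restrict_PiE_iff[THEN iffD2]) auto
    ultimately show "x \<in> (\<lambda>\<B>. \<Sum>i=0..s. p i * real (card (\<B> i))) ` ?F"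
      by blast
  qed
  moreover have "finite ?F"
    by (intro finite_PiE) (auto intro!: finite_imp_finite_nsets)
  ultimately show "finite S"
    by (meson finite_imageI finite_subset)
  have "overlapping s (\<lambda>_. {})"
    unfolding overlapping_iff by auto
  then have "(\<Sum>i=0..s. p i * real (card ((\<lambda>_. {} :: nat set set) i))) \<in> S"
    unfolding S_def by (intro CollectI exI[of _ "\<lambda>_. {}"]) (auto simp: mono_on_def)
  then show "S \<noteq> {}" by blast
qed

end

theory Submission
  imports Defs "HOL-Combinatorics.Permutations"
begin

text \<open>
  For the upper bound, average over all ordered partitions of \<open>{1..(s + 1) * k}\<close> into \<open>k\<close>-sets.
  If a partition has \<open>b i\<close> blocks in \<open>\<B> i\<close>, then \<open>b i \<le> i\<close> for some \<open>i\<close>: otherwise distinct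
  blocks could be chosen greedily. As \<open>b\<close> increases and \<open>p\<close> decreases, this forces
  \<open>(\<Sum>i. p i * b i) \<le> s * (\<Sum>i. p i)\<close>, and a given \<open>k\<close>-set occurs equally often in each block.
  Equality is attained when every \<open>\<B> i\<close> consists of the \<open>k\<close>-sets avoiding one fixed point, since
  \<open>s + 1\<close> disjoint \<open>k\<close>-sets cover the whole ground set.
\<close>

section \<open>Permutations counted by the image of a given set\<close>

lemma ex_permutes_image_eq:
  assumes "finite V" "A \<subseteq> V" "B \<subseteq> V" "card A = card B"
  obtains \<sigma> where "\<sigma> permutes V" "\<sigma> ` A = B"
proof -
  have fin: "finite A" "finite B"
    using assms finite_subset by auto
  obtain f where f: "bij_betw f A B"
    using finite_same_card_bij[OF fin assms(4)] by blast
  have "card (V - A) = card (V - B)"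
    using assms fin by (simp add: card_Diff_subset)
  then obtain g where g: "bij_betw g (V - A) (V - B)"
    using finite_same_card_bij[of "V - A" "V - B"] assms(1) by blast
  \<comment> \<open>Two bijections are glued, one on \<open>A\<close> and one on its complement in
    \<open>V\<close>; equal cardinalities of \<open>A\<close> and \<open>B\<close> give the
    second.\<close>
  define \<sigma> where "\<sigma> = (\<lambda>x. if x \<in> A then f x else if x \<in> V then g x else x)"
  have A: "bij_betw \<sigma> A B"
    using f by (subst bij_betw_cong[of A \<sigma> f]) (auto simp: \<sigma>_def)
  have "bij_betw \<sigma> (V - A) (V - B)"
    using g by (subst bij_betw_cong[of "V - A" \<sigma> g]) (auto simp: \<sigma>_def)
  with A have "bij_betw \<sigma> (A \<union> (V - A)) (B \<union> (V - B))"
    by (rule bij_betw_combine) auto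
  moreover have "A \<union> (V - A) = V" "B \<union> (V - B) = V"
    using assms by auto
  ultimately have "\<sigma> permutes V"
    using assms(2) by (intro bij_imp_permutes) (auto simp: \<sigma>_def)
  then show thesis
    using that A by (auto simp: bij_betw_def)
qed

lemma card_permutes_image_eq:
  assumes "finite V" "T \<in> nsets V k" "A \<in> nsets V k"
  shows "card {\<pi>. \<pi> permutes V \<and> \<pi> ` T = A} * (card V choose k) = fact (card V)"
proof -
  define c where "c B = card {\<pi>. \<pi> permutes V \<and> \<pi> ` T = B}" for B
  \<comment> \<open>Composing on the left with a permutation that carries \<open>B\<close> to
    \<open>C\<close> injects one fibre into the other. As \<open>B\<close> and \<open>C\<close> are
    arbitrary, exchanging them yields equality.\<close>
  have le: "c B \<le> c C" if "B \<in> nsets V k" "C \<in> nsets V k" for B C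
  proof -
    have "B \<subseteq> V" "C \<subseteq> V" "card B = card C"
      using that by (auto simp: nsets_def)
    then obtain \<sigma> where \<sigma>: "\<sigma> permutes V" "\<sigma> ` B = C"
      using assms(1) by (metis ex_permutes_image_eq)
    have "inj \<sigma>"
      using \<sigma>(1) by (rule permutes_inj)
    then have "inj_on ((\<circ>) \<sigma>) {\<pi>. \<pi> permutes V \<and> \<pi> ` T = B}"
      by (auto simp: inj_on_def fun_eq_iff)
    then show ?thesis
      unfolding c_def
    proof (rule card_inj_on_le)
      show "(\<circ>) \<sigma> ` {\<pi>. \<pi> permutes V \<and> \<pi> ` T = B} \<subseteq> {\<pi>. \<pi> permutes V \<and> \<pi> ` T = C}"
        using \<sigma> by (auto simp: permutes_compose image_comp[symmetric])
    qed (simp add: finite_permutations assms(1))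
  qed
  then have c_eq: "c B = c A" if "B \<in> nsets V k" for B
    using that assms(3) by (meson le_antisym)
  have "{\<pi>. \<pi> permutes V} = (\<Union>B\<in>nsets V k. {\<pi>. \<pi> permutes V \<and> \<pi> ` T = B})"
  proof -
    have "\<pi> ` T \<in> nsets V k" if "\<pi> permutes V" for \<pi>
      using that assms(2) permutes_image[OF that] permutes_inj_on[OF that]
      by (auto simp: nsets_def card_image)
    then show ?thesis by auto
  qed
  then have "card {\<pi>. \<pi> permutes V} = (\<Sum>B\<in>nsets V k. c B)"
    unfolding c_def
    by (subst card_UN_disjoint[symmetric])
       (auto simp: finite_permutations assms(1) finite_imp_finite_nsets)
  also have "\<dots> = card (nsets V k) * c A"
    using c_eq by simp
  finally show ?thesis
    using assms(1) by (simp add: card_permutations c_def card_nsets)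
qed

text \<open>Double counting: each pair of an index \<open>j\<close> and a set \<open>A\<close> in
  \<open>\<B>\<close> is hit by the same number of permutations, namely the fibre size just
  computed.\<close>

lemma sum_permutes_card_image_mem:
  assumes "finite V" "finite J" "\<And>j. j \<in> J \<Longrightarrow> T j \<in> nsets V k" "\<B> \<subseteq> nsets V k"
  shows "(\<Sum>\<pi> | \<pi> permutes V. card {j \<in> J. \<pi> ` T j \<in> \<B>}) * (card V choose k)
           = card J * card \<B> * fact (card V)"
proof -
  let ?G = "{\<pi>. \<pi> permutes V}"
  have finG: "finite ?G"
    by (simp add: finite_permutations assms(1))
  have finB: "finite \<B>"
    using assms(1,4) finite_imp_finite_nsets finite_subset by blast
  have "(\<Sum>\<pi>\<in>?G. card {j \<in> J. \<pi> ` T j \<in> \<B>}) = (\<Sum>j\<in>J. card {\<pi> \<in> ?G. \<pi> ` T j \<in> \<B>})"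
    using sum_multicount_gen[OF finG assms(2), of "\<lambda>\<pi> j. \<pi> ` T j \<in> \<B>"] by simp
  also have "\<dots> = (\<Sum>j\<in>J. \<Sum>A\<in>\<B>. card {\<pi>. \<pi> permutes V \<and> \<pi> ` T j = A})"
  proof (rule sum.cong[OF refl])
    fix j
    have "{\<pi> \<in> ?G. \<pi> ` T j \<in> \<B>} = (\<Union>A\<in>\<B>. {\<pi>. \<pi> permutes V \<and> \<pi> ` T j = A})"
      by auto
    then show "card {\<pi> \<in> ?G. \<pi> ` T j \<in> \<B>} = (\<Sum>A\<in>\<B>. card {\<pi>. \<pi> permutes V \<and> \<pi> ` T j = A})"
      by (simp only:) (subst card_UN_disjoint, auto simp: finB finG)
  qed
  finally have "(\<Sum>\<pi>\<in>?G. card {j \<in> J. \<pi> ` T j \<in> \<B>}) * (card V choose k)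
      = (\<Sum>j\<in>J. \<Sum>A\<in>\<B>. card {\<pi>. \<pi> permutes V \<and> \<pi> ` T j = A} * (card V choose k))"
    by (simp add: sum_distrib_right)
  also have "\<dots> = (\<Sum>j\<in>J. \<Sum>A\<in>\<B>. fact (card V))"
    using assms by (intro sum.cong refl card_permutes_image_eq) auto
  finally show ?thesis by simp
qed

section \<open>The weight inequality for a single partition\<close>

text \<open>Greedy choice: the \<open>m\<close> representatives already picked cannot exhaust
  \<open>J m\<close>, which has more than \<open>m\<close> elements.\<close>

lemma ex_distinct_representatives_of_card_gt:
  fixes J :: "nat \<Rightarrow> 'a set"
  assumes "\<And>i. i < m \<Longrightarrow> i < card (J i)"
  shows "\<exists>g. inj_on g {..<m} \<and> (\<forall>i<m. g i \<in> J i)"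
  using assms
proof (induction m)
  case (Suc m)
  then obtain g where g: "inj_on g {..<m}" "\<forall>i<m. g i \<in> J i"
    by (metis less_SucI)
  have "\<not> J m \<subseteq> g ` {..<m}"
  proof
    assume "J m \<subseteq> g ` {..<m}"
    then have "card (J m) \<le> m"
      using card_mono[of "g ` {..<m}" "J m"] card_image_le[of "{..<m}" g] by simp
    then show False
      using Suc.prems[of m] by simp
  qed
  then obtain x where x: "x \<in> J m" "x \<notin> g ` {..<m}" by blast
  have "inj_on (g(m := x)) {..<Suc m}"
    using g(1) x(2) by (auto simp: lessThan_Suc inj_on_def)
  moreover have "\<forall>i<Suc m. (g(m := x)) i \<in> J i"
    using g(2) x(1) by (auto simp: less_Suc_eq)
  ultimately show ?case by blast
qed simp

text \<open>The bound says that the weighted slacks \<open>p i * (s - b i)\<close> have a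
  nonnegative sum. Only indices above \<open>m\<close> can have negative slack, and the slack at
  \<open>m\<close> alone compensates for all of them.\<close>

lemma sum_antimono_weights_le:
  fixes p :: "nat \<Rightarrow> real" and b :: "nat \<Rightarrow> nat"
  assumes p: "antimono_on {0..s} p" "p s \<ge> 0"
    and b: "mono_on {0..s} b" "\<And>i. i \<le> s \<Longrightarrow> b i \<le> s + 1"
    and m: "m \<le> s" "b m \<le> m"
  shows "(\<Sum>i=0..s. p i * real (b i)) \<le> real s * (\<Sum>i=0..s. p i)"
proof -
  have anti: "p j \<le> p i" if "i \<le> j" "j \<le> s" for i j
    using monotone_onD[OF p(1), of i j] that by simp
  have nonneg: "0 \<le> p i" if "i \<le> s" for i
    using anti[of i s] p(2) that by simp
  define d where "d i = p i * (real s - real (b i))" for i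
  have "real (s - m) * p m = p m * (real s - real m)"
    using m(1) by (simp add: of_nat_diff)
  also have "\<dots> \<le> d m"
    unfolding d_def using m nonneg by (intro mult_left_mono) auto
  \<comment> \<open>Up to \<open>m\<close> no slack is negative, since
    \<open>b i \<le> b m \<le> m \<le> s\<close> there, so the term at \<open>m\<close> may stand
    for the whole sum.\<close>
  also have "\<dots> \<le> (\<Sum>i=0..m. d i)"
  proof (rule member_le_sum)
    fix i assume "i \<in> {0..m} - {m}"
    then have "i \<le> m" by simp
    then have "b i \<le> m"
      using monotone_onD[OF b(1), of i m] m by simp
    then show "0 \<le> d i"
      unfolding d_def using m \<open>i \<le> m\<close> by (intro mult_nonneg_nonneg nonneg) auto
  qed auto
  finally have low: "real (s - m) * p m \<le> (\<Sum>i=0..m. d i)" .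
  \<comment> \<open>Since \<open>b i\<close> exceeds \<open>s\<close> by at most 1, each of these
    \<open>s - m\<close> terms loses at most \<open>p i\<close>, hence at most
    \<open>p m\<close>.\<close>
  have "(\<Sum>i=Suc m..s. - p m) \<le> (\<Sum>i=Suc m..s. d i)"
  proof (rule sum_mono)
    fix i assume i: "i \<in> {Suc m..s}"
    have "- p m \<le> - p i"
      using anti[of m i] i by simp
    also have "\<dots> = p i * (-1)" by simp
    also have "\<dots> \<le> d i"
      unfolding d_def using b(2)[of i] nonneg[of i] i by (intro mult_left_mono) auto
    finally show "- p m \<le> d i" .
  qed
  then have "- (real (s - m) * p m) \<le> (\<Sum>i=Suc m..s. d i)"
    by simp
  with low have "0 \<le> (\<Sum>i=0..m. d i) + (\<Sum>i=Suc m..s. d i)"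
    by linarith
  also have "\<dots> = (\<Sum>i=0..s. d i)"
    using sum.ub_add_nat[of 0 m d "s - m"] m(1) by simp
  also have "\<dots> = real s * (\<Sum>i=0..s. p i) - (\<Sum>i=0..s. p i * real (b i))"
    by (simp add: d_def right_diff_distrib sum_subtractf sum_distrib_left mult.commute)
  finally show ?thesis by simp
qed

text \<open>Let \<open>J i\<close> be the set of blocks lying in \<open>\<B> i\<close>. If every
  \<open>J i\<close> had more than \<open>i\<close> elements, distinct representatives would form a
  full rainbow matching. So \<open>card (J m) \<le> m\<close> for some \<open>m\<close>, and the
  weight inequality applies.\<close>

lemma overlapping_weight_on_disjoint_family_le:
  fixes p :: "nat \<Rightarrow> real"
  assumes p: "antimono_on {0..s} p" "p s \<ge> 0"
    and \<B>: "mono_on {0..s} \<B>" "overlapping s \<B>"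
    and M: "disjoint_family_on M {0..s}"
  shows "(\<Sum>i=0..s. p i * real (card {j \<in> {0..s}. M j \<in> \<B> i})) \<le> real s * (\<Sum>i=0..s. p i)"
proof -
  define J where "J i = {j \<in> {0..s}. M j \<in> \<B> i}" for i
  have "\<exists>m\<le>s. card (J m) \<le> m"
  proof (rule ccontr)
    assume "\<not> ?thesis"
    then have "\<And>i. i < Suc s \<Longrightarrow> i < card (J i)"
      by (meson less_Suc_eq_le not_le)
    then obtain g where g: "inj_on g {..<Suc s}" "\<forall>i<Suc s. g i \<in> J i"
      using ex_distinct_representatives_of_card_gt[of "Suc s" J] by blast
    have "disjoint_family_on (\<lambda>i. M (g i)) {0..s}"
      unfolding disjoint_family_on_def
    proof (intro ballI impI)
      fix i j assume ij: "i \<in> {0..s}" "j \<in> {0..s}" "i \<noteq> j"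
      then have "g i \<in> {0..s}" "g j \<in> {0..s}" "g i \<noteq> g j"
        using g by (auto simp: J_def less_Suc_eq_le dest: inj_onD)
      then show "M (g i) \<inter> M (g j) = {}"
        using M by (simp add: disjoint_family_on_def)
    qed
    moreover have "\<forall>i\<in>{0..s}. M (g i) \<in> \<B> i"
      using g(2) by (auto simp: J_def less_Suc_eq_le)
    ultimately show False
      using \<B>(2) unfolding overlapping_iff by (metis (no_types, lifting))
  qed
  then obtain m where m: "m \<le> s" "card (J m) \<le> m" by blast
  have "mono_on {0..s} (\<lambda>i. card (J i))"
  proof (rule mono_onI)
    fix i j assume "i \<in> {0..s}" "j \<in> {0..s}" "i \<le> j"
    then have "\<B> i \<subseteq> \<B> j"
      using mono_onD[OF \<B>(1)] by blast
    then show "card (J i) \<le> card (J j)"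
      by (intro card_mono) (auto simp: J_def)
  qed
  moreover have "card (J i) \<le> s + 1" for i
  proof -
    have "J i \<subseteq> {0..s}"
      by (auto simp: J_def)
    then show ?thesis
      using card_mono[of "{0..s}" "J i"] by simp
  qed
  ultimately show ?thesis
    using sum_antimono_weights_le[OF p, of "\<lambda>i. card (J i)" m] m by (simp add: J_def)
qed

section \<open>Averaging over all partitions\<close>

lemma overlapping_weight_le:
  fixes p :: "nat \<Rightarrow> real"
  assumes k: "k \<ge> 1"
    and p: "antimono_on {0..s} p" "p s \<ge> 0"
    and \<B>: "mono_on {0..s} \<B>" "\<And>i. i \<le> s \<Longrightarrow> \<B> i \<subseteq> nsets {1..(s + 1) * k} k" "overlapping s \<B>"
  shows "(\<Sum>i=0..s. p i * real (card (\<B> i))) \<le> (\<Sum>i=0..s. p i) * real (((s + 1) * k - 1) choose k)"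
proof -
  define n where "n = (s + 1) * k"
  define N where "N = n choose k"
  define G where "G = {\<pi>. \<pi> permutes {1..n}}"
  \<comment> \<open>Consecutive intervals of length \<open>k\<close> cut \<open>{1..n}\<close> into
    \<open>s + 1\<close> blocks; their images under all permutations run through the ordered
    partitions.\<close>
  define T where "T j = {j * k + 1..(j + 1) * k}" for j :: nat
  define b where "b \<pi> i = card {j \<in> {0..s}. \<pi> ` T j \<in> \<B> i}" for \<pi> :: "nat \<Rightarrow> nat" and i
  have "k \<le> n"
    by (simp add: n_def)
  then have N: "N > 0"
    by (simp add: N_def zero_less_binomial)
  have T: "T j \<in> nsets {1..n} k" if "j \<in> {0..s}" for j
  proof -
    have "(j + 1) * k \<le> (s + 1) * k"
      using that by (intro mult_right_mono) auto
    then show ?thesis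
      unfolding T_def nsets_def n_def by auto
  qed
  have T_less: "T i \<inter> T j = {}" if "i < j" for i j
  proof -
    have "(i + 1) * k \<le> j * k"
      using that by (intro mult_right_mono) auto
    then show ?thesis
      by (auto simp: T_def)
  qed
  have T_disj: "T i \<inter> T j = {}" if "i \<noteq> j" for i j
    using T_less[of i j] T_less[of j i] that by (cases i j rule: linorder_cases) auto
  have "(\<Sum>i=0..s. p i * real (b \<pi> i)) \<le> real s * (\<Sum>i=0..s. p i)" if "\<pi> \<in> G" for \<pi>
  proof -
    have "inj \<pi>"
      using that by (auto simp: G_def intro: permutes_inj)
    then have "disjoint_family_on (\<lambda>j. \<pi> ` T j) {0..s}"
      using T_disj by (auto simp: disjoint_family_on_def image_Int[symmetric])
    then show ?thesis
      unfolding b_def by (rule overlapping_weight_on_disjoint_family_le[OF p \<B>(1,3)])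
  qed
  then have "(\<Sum>\<pi>\<in>G. \<Sum>i=0..s. p i * real (b \<pi> i)) \<le> (\<Sum>\<pi>\<in>G. real s * (\<Sum>i=0..s. p i))"
    by (rule sum_mono)
  also have "\<dots> = fact n * (real s * (\<Sum>i=0..s. p i))"
    by (simp add: G_def card_permutations)
  \<comment> \<open>The factor \<open>N\<close> prepares for the product form of the double
    count.\<close>
  finally have "real N * (\<Sum>\<pi>\<in>G. \<Sum>i=0..s. p i * real (b \<pi> i))
      \<le> real N * (fact n * (real s * (\<Sum>i=0..s. p i)))"
    by (intro mult_left_mono) auto
  \<comment> \<open>Exchanging the sums isolates each \<open>\<B> i\<close>; the factor
    \<open>s + 1\<close> is the number of blocks in which a member of \<open>\<B> i\<close> can
    appear.\<close>
  moreover have "real N * (\<Sum>\<pi>\<in>G. \<Sum>i=0..s. p i * real (b \<pi> i))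
      = fact n * (real (s + 1) * (\<Sum>i=0..s. p i * real (card (\<B> i))))"
  proof -
    have "real N * (\<Sum>\<pi>\<in>G. \<Sum>i=0..s. p i * real (b \<pi> i))
        = (\<Sum>i=0..s. p i * real ((\<Sum>\<pi>\<in>G. b \<pi> i) * N))"
      by (subst sum.swap) (simp add: sum_distrib_left sum_distrib_right mult_ac)
    also have "\<dots> = (\<Sum>i=0..s. p i * real ((s + 1) * card (\<B> i) * fact n))"
    proof (intro sum.cong refl)
      fix i assume "i \<in> {0..s}"
      then have "\<B> i \<subseteq> nsets {1..n} k"
        using \<B>(2) by (simp add: n_def)
      then have "(\<Sum>\<pi>\<in>G. b \<pi> i) * N = (s + 1) * card (\<B> i) * fact n"
        using sum_permutes_card_image_mem[of "{1..n}" "{0..s}" T k "\<B> i"] T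
        by (simp add: G_def b_def N_def)
      then show "p i * real ((\<Sum>\<pi>\<in>G. b \<pi> i) * N) = p i * real ((s + 1) * card (\<B> i) * fact n)"
        by simp
    qed
    finally show ?thesis
      by (simp add: sum_distrib_left algebra_simps)
  qed
  ultimately have "fact n * (real (s + 1) * (\<Sum>i=0..s. p i * real (card (\<B> i))))
      \<le> fact n * (real N * (real s * (\<Sum>i=0..s. p i)))"
    by (simp only: mult_ac)
  then have "real (s + 1) * (\<Sum>i=0..s. p i * real (card (\<B> i))) \<le> real N * (real s * (\<Sum>i=0..s. p i))"
    by (simp del: of_nat_Suc of_nat_add)
  also have "\<dots> = real (s * N) * (\<Sum>i=0..s. p i)"
    by simp
  \<comment> \<open>With \<open>n - k = s * k\<close>, the absorption identity turns the fraction
    \<open>s / (s + 1)\<close> of \<open>n choose k\<close> into \<open>(n - 1) choose k\<close>.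
    Cancelling \<open>k\<close> uses that it is positive.\<close>
  also have "s * N = (s + 1) * ((n - 1) choose k)"
  proof -
    have "k * (s * N) = (n - k) * (n choose k)"
      by (simp add: n_def N_def mult_ac)
    also have "\<dots> = n * ((n - 1) choose k)"
      by (rule binomial_absorb_comp)
    also have "\<dots> = k * ((s + 1) * ((n - 1) choose k))"
      by (simp add: n_def algebra_simps)
    finally show ?thesis
      using k by (metis mult_left_cancel not_one_le_zero)
  qed
  finally have "real (s + 1) * (\<Sum>i=0..s. p i * real (card (\<B> i)))
      \<le> real (s + 1) * ((\<Sum>i=0..s. p i) * real ((n - 1) choose k))"
    by (simp only: of_nat_mult mult_ac)
  then show ?thesis
    unfolding n_def by (subst (asm) mult_le_cancel_left_pos) auto
qed

section \<open>The extremal configuration\<close>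

text \<open>A full rainbow matching would need \<open>(s + 1) * k\<close> distinct points, more than
  the \<open>m\<close> available.\<close>

lemma overlapping_nsets:
  assumes "m < (s + 1) * k"
  shows "overlapping s (\<lambda>_. nsets {1..m} k)"
  unfolding overlapping_iff
proof
  assume "\<exists>M. (\<forall>i\<in>{0..s}. M i \<in> nsets {1..m} k) \<and> disjoint_family_on M {0..s}"
  then obtain M where M: "\<And>i. i \<in> {0..s} \<Longrightarrow> M i \<in> nsets {1..m} k" "disjoint_family_on M {0..s}"
    by blast
  have "card (\<Union>i\<in>{0..s}. M i) = (\<Sum>i\<in>{0..s}. card (M i))"
    using M by (intro card_UN_disjoint) (auto simp: disjoint_family_on_def nsets_def)
  also have "\<dots> = (s + 1) * k"
    using M(1) by (simp add: nsets_def)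
  finally have "card (\<Union>i\<in>{0..s}. M i) = (s + 1) * k" .
  moreover have "card (\<Union>i\<in>{0..s}. M i) \<le> card {1..m}"
    using M(1) by (intro card_mono UN_least) (simp_all add: nsets_def)
  ultimately show False
    using assms by simp
qed

theorem theorem1p5:
  fixes k s :: nat and p :: "nat \<Rightarrow> real"
  assumes "k \<ge> 1" and "s \<ge> 1"
    and "antimono_on {0..s} p" and "p s > 0"
  shows "max_weight p ((s + 1) * k) k s
           = (\<Sum>i=0..s. p i) * real (((s + 1) * k - 1) choose k)"
  unfolding max_weight_def
proof (rule Max_eqI[OF max_weight_set_finite_nonempty(1)])
  fix y
  assume "y \<in> {(\<Sum>i=0..s. p i * real (card (\<B> i))) | \<B>. mono_on {0..s} \<B> \<and>
      (\<forall>i\<in>{0..s}. \<B> i \<subseteq> nsets {1..(s + 1) * k} k) \<and> overlapping s \<B>}"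
  then show "y \<le> (\<Sum>i=0..s. p i) * real (((s + 1) * k - 1) choose k)"
    using overlapping_weight_le[OF assms(1,3)] assms(4) by auto
next
  \<comment> \<open>All families coincide, and the point avoided is the largest one,
    \<open>(s + 1) * k\<close>. As \<open>k\<close> is positive, the subtraction does remove a
    point.\<close>
  let ?\<B> = "\<lambda>_ :: nat. nsets {1..(s + 1) * k - 1} k"
  have "overlapping s ?\<B>"
    using assms(1) by (intro overlapping_nsets) simp
  moreover have "nsets {1..(s + 1) * k - 1} k \<subseteq> nsets {1..(s + 1) * k} k"
    by (rule nsets_mono) auto
  moreover have "(\<Sum>i=0..s. p i) * real (((s + 1) * k - 1) choose k)
      = (\<Sum>i=0..s. p i * real (card (?\<B> i)))"
    by (simp add: card_nsets sum_distrib_right)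
  ultimately show "(\<Sum>i=0..s. p i) * real (((s + 1) * k - 1) choose k)
      \<in> {(\<Sum>i=0..s. p i * real (card (\<B> i))) | \<B>. mono_on {0..s} \<B> \<and>
          (\<forall>i\<in>{0..s}. \<B> i \<subseteq> nsets {1..(s + 1) * k} k) \<and> overlapping s \<B>}"
    by (intro CollectI exI[of _ ?\<B>]) (auto simp: mono_on_def)
qed

end
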